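(* Let $\Sigma$ be a signed graph on $n$ vertices with spanning subgraph $\Sigma_+$ comprising its $m^+$ positive edges and spanning subgraph $\Sigma_-$ comprising its $m^-$ negative edges. Let $\epsilon_b(\Sigma_+)$ be the edge bipartiteness of $\Sigma_+$ and let $\delta_-$ be the minimum degree of $-\Sigma_-$. Then \[\lambda_n(\Sigma)\ge-\sqrt{m^+-\epsilon_b(\Sigma_+)}-\frac{\delta_--1}{2}-\sqrt{2m^--n\delta_-+\frac{(1+\delta_-)^2}{4}}.\] If $m^+\ge1$, equality holds in this inequality if and only if the vertex set can be partitioned as a disjoint union $V(\Sigma)=S_1\,\dot\cup\,S_2\,\dot\cup\,Z$ with $S_1,S_2\ne\emptyset$ such that the following conditions hold: (C1) $\Sigma_+$ is the disjoint union of a complete bipartite graph $K_{a,b}$ with parts $S_1,S_2$ and $t=|Z|$ isolated vertices (the vertices of $Z$); (C2) $-\Sigma_-$ is $\delta_-$-regular; (C3) no negative edges join $Z$ to $S_1\cup S_2$.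
   Context: A signed graph $\Sigma=(G,\sigma)$ is a finite simple graph $G=(V,E)$ with a sign function $\sigma:E\to\{-1,+1\}$; its adjacency matrix $A(\Sigma)$ has $(i,j)$ entry $\sigma(v_iv_j)$ if $v_i\sim v_j$ and $0$ otherwise, and $\lambda_n(\Sigma)$ is its least eigenvalue. $\Sigma_+$ and $\Sigma_-$ are the subgraphs with vertex set $V$ whose edges are respectively all the positive and all the negative edges of $\Sigma$. $-\Sigma_-$ is $\Sigma_-$ with all signs reversed, i.e. the unsigned graph on $V$ whose edges are the negative edges of $\Sigma$; its minimum degree is taken over all $n$ vertices. The edge bipartiteness $\epsilon_b(G)$ of a graph $G$ is the minimum number of edges whose removal makes $G$ bipartite. The set $Z$ is allowed to be empty. *)

theory Defs
  imports "Jordan_Normal_Form.Spectral_Radius"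
begin

text \<open>A graph is given by its vertex set \<open>V\<close> and its set \<open>E\<close> of edges; an edge is an unordered
  pair of distinct vertices.\<close>

locale simple_graph =
  fixes V :: "'v set" and E :: "'v set set"
  assumes finite_vertices: "finite V"
    and edges_subset: "E \<subseteq> {{u, w} | u w. u \<in> V \<and> w \<in> V \<and> u \<noteq> w}"

locale signed_graph = simple_graph V E
  for V :: "'v set" and E :: "'v set set" +
  fixes \<sigma> :: "'v set \<Rightarrow> real"
  assumes sign_values: "e \<in> E \<Longrightarrow> \<sigma> e \<in> {-1, 1}"

definition pos_edges :: "'v set set \<Rightarrow> ('v set \<Rightarrow> real) \<Rightarrow> 'v set set" where
  "pos_edges E \<sigma> = {e \<in> E. \<sigma> e = 1}"

definition neg_edges :: "'v set set \<Rightarrow> ('v set \<Rightarrow> real) \<Rightarrow> 'v set set" where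
  "neg_edges E \<sigma> = {e \<in> E. \<sigma> e = -1}"

text \<open>The list \<open>vs\<close> enumerates the vertices. The diagonal is zero since a singleton \<open>{v, v}\<close> is
  never an edge of a simple graph.\<close>

definition adjacency_matrix :: "'v list \<Rightarrow> 'v set set \<Rightarrow> ('v set \<Rightarrow> real) \<Rightarrow> real mat" where
  "adjacency_matrix vs E \<sigma> =
     mat (length vs) (length vs)
       (\<lambda>(i, j). if {vs ! i, vs ! j} \<in> E then \<sigma> {vs ! i, vs ! j} else 0)"

text \<open>Only used for symmetric real matrices of positive dimension, whose spectrum over the reals is
  finite and nonempty and comprises all complex eigenvalues.\<close>

definition least_eigenvalue :: "real mat \<Rightarrow> real" where
  "least_eigenvalue A = Min (spectrum A)"

definition vertex_degree :: "'v set set \<Rightarrow> 'v \<Rightarrow> nat" where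
  "vertex_degree E v = card {e \<in> E. v \<in> e}"

definition min_degree :: "'v set \<Rightarrow> 'v set set \<Rightarrow> nat" where
  "min_degree V E = Min (vertex_degree E ` V)"

definition regular_graph :: "'v set \<Rightarrow> 'v set set \<Rightarrow> nat \<Rightarrow> bool" where
  "regular_graph V E d \<longleftrightarrow> (\<forall>v\<in>V. vertex_degree E v = d)"

definition bipartite :: "'v set \<Rightarrow> 'v set set \<Rightarrow> bool" where
  "bipartite V E \<longleftrightarrow>
     (\<exists>A B. A \<union> B = V \<and> A \<inter> B = {} \<and> (\<forall>e\<in>E. \<exists>a\<in>A. \<exists>b\<in>B. e = {a, b}))"

definition edge_bipartiteness :: "'v set \<Rightarrow> 'v set set \<Rightarrow> nat" where
  "edge_bipartiteness V E = Min (card ` {F. F \<subseteq> E \<and> bipartite V (E - F)})"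

definition complete_bipartite_edges :: "'v set \<Rightarrow> 'v set \<Rightarrow> 'v set set" where
  "complete_bipartite_edges A B = {{a, b} | a b. a \<in> A \<and> b \<in> B}"

end

theory Submission
  imports Defs "HOL-Analysis.Function_Topology"
begin

text \<open>
  Write the adjacency matrix as \<open>A = P - H\<close>, where \<open>P\<close> and \<open>H\<close> are the 0/1 adjacency matrices of the
  graphs of positive and of negative edges. The least eigenvalue is the minimum of the quadratic form
  of \<open>A\<close> on unit vectors, so it is at least the minimum of the form of \<open>P\<close> minus the maximum of the
  form of \<open>H\<close>. The first square root bounds the former, and the other two terms
  together bound the latter.

  For \<open>P\<close>, separate the nonnegative from the negative entries of a unit vector \<open>x\<close>. Edges inside a side
  contribute nonnegative terms; the edges across form a cut and so number at most
  \<open>k = m\<^sup>+ - \<epsilon>\<^sub>b\<close>, and the Cauchy-Schwarz inequality over all pairs across bounds their contribution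
  by \<open>- \<surd>k\<close> (\<open>quad_adj_ge_sqrt_cut\<close>). For \<open>H\<close>, the argument of Hong, Shu and Fang applies: every row sum
  of \<open>H\<^sup>2 - (\<delta> - 1) H\<close> is at most \<open>2 m - (n - 1) \<delta>\<close>, and pairing with a nonnegative eigenvector for the
  largest eigenvalue \<open>\<rho>\<close> gives \<open>\<rho>\<^sup>2 - (\<delta> - 1) \<rho> \<le> 2 m - (n - 1) \<delta>\<close> (\<open>quad_adj_le\<close>).

  In case of equality a unit minimizer \<open>x\<close> for \<open>A\<close> is extremal for both bounds. Equality in
  Cauchy-Schwarz says that for every \<open>u \<noteq> v\<close> with \<open>x u \<ge> 0 \<ge> x v\<close> the entry \<open>P u v\<close> equals
  \<open>- 2 \<surd>k x u x v\<close>, and there are no positive edges between entries of equal strict sign.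
  Hence \<open>P\<close> is complete bipartite between \<open>S1 = {x > 0}\<close> and \<open>S2 = {x < 0}\<close>, and isolates
  \<open>Z = {x = 0}\<close>. The vector \<open>\<bar>x\<bar>\<close> is also extremal for \<open>H\<close>, hence a nonnegative eigenvector of \<open>H\<close>; its
  eigenvector equation at \<open>Z\<close> rules out negative edges between \<open>Z\<close> and the rest. Equality of the row
  sums says that a vertex has negative degree \<open>\<delta>\<close> as soon as it is not joined by a negative edge to some
  other vertex of \<open>S1 \<union> S2\<close>. This applies to every vertex, because neither \<open>S1\<close> and \<open>S2\<close>, nor \<open>Z\<close> and
  \<open>S1 \<union> S2\<close>, are joined by negative edges (\<open>extremal_partition_of_minimizer\<close>). Conversely, the
  vector with values \<open>\<surd>|S2|\<close> on \<open>S1\<close>, \<open>- \<surd>|S1|\<close> on \<open>S2\<close> and \<open>0\<close> on \<open>Z\<close> attains the bound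
  (\<open>minimizer_of_extremal_partition\<close>).
\<close>

section \<open>Quadratic forms and extremal eigenvectors\<close>

definition quad :: "'i set \<Rightarrow> ('i \<Rightarrow> 'i \<Rightarrow> real) \<Rightarrow> ('i \<Rightarrow> real) \<Rightarrow> real" where
  "quad I w x = (\<Sum>i\<in>I. \<Sum>j\<in>I. w i j * x i * x j)"

lemma quad_uminus: "quad I (\<lambda>i j. - w i j) x = - quad I w x"
  by (simp add: quad_def sum_negf)

lemma quad_eigenvector:
  assumes "\<And>i. i \<in> I \<Longrightarrow> (\<Sum>j\<in>I. w i j * x j) = \<mu> * x i"
  shows "quad I w x = \<mu> * (\<Sum>i\<in>I. (x i)\<^sup>2)"
proof -
  have "quad I w x = (\<Sum>i\<in>I. x i * (\<Sum>j\<in>I. w i j * x j))"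
    by (simp add: quad_def sum_distrib_left mult_ac)
  also have "\<dots> = (\<Sum>i\<in>I. \<mu> * (x i)\<^sup>2)"
    using assms by (intro sum.cong) (auto simp: power2_eq_square)
  finally show ?thesis by (simp add: sum_distrib_left)
qed

text \<open>
  A vector at which \<open>quad I w y - \<mu> \<parallel>y\<parallel>\<^sup>2 \<ge> 0\<close> vanishes is a critical point of this form: moving
  it by \<open>t\<close> in direction \<open>k\<close> changes the form by \<open>2 t g + t\<^sup>2 c\<close>, where \<open>g\<close> is the defect of the
  eigenvector equation at \<open>k\<close>, and this is nonnegative for all \<open>t\<close> only if \<open>g = 0\<close>.
\<close>

lemma minimizer_eigenvector:
  fixes w :: "'i \<Rightarrow> 'i \<Rightarrow> real"
  assumes fin: "finite I" and sym: "\<And>i j. w i j = w j i"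
    and lower: "\<And>y. \<mu> * (\<Sum>i\<in>I. (y i)\<^sup>2) \<le> quad I w y"
    and attained: "quad I w x = \<mu> * (\<Sum>i\<in>I. (x i)\<^sup>2)"
    and k: "k \<in> I"
  shows "(\<Sum>j\<in>I. w k j * x j) = \<mu> * x k"
proof -
  define g where "g = (\<Sum>j\<in>I. w k j * x j) - \<mu> * x k"
  define c where "c = w k k - \<mu>"
  have expand: "quad I w (\<lambda>i. x i + (if i = k then t else 0))
      = quad I w x + 2 * t * (\<Sum>j\<in>I. w k j * x j) + t\<^sup>2 * w k k" for t
  proof -
    have "quad I w (\<lambda>i. x i + (if i = k then t else 0))
      = (\<Sum>i\<in>I. \<Sum>j\<in>I. w i j * x i * x j + (if i = k then t * (w k j * x j) else 0)
          + (if j = k then t * (w i k * x i) else 0)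
          + (if i = k then if j = k then t\<^sup>2 * w k k else 0 else 0))"
      unfolding quad_def
      by (intro sum.cong refl) (auto simp: algebra_simps power2_eq_square)
    also have "\<dots> = quad I w x + (\<Sum>j\<in>I. t * (w k j * x j)) + (\<Sum>i\<in>I. t * (w i k * x i))
        + t\<^sup>2 * w k k"
    proof -
      have "(\<Sum>i\<in>I. \<Sum>j\<in>I. if i = k then t * (w k j * x j) else 0) = (\<Sum>j\<in>I. t * (w k j * x j))"
        using fin k by (subst sum.swap) simp
      moreover have "(\<Sum>i\<in>I. \<Sum>j\<in>I. if i = k then if j = k then t\<^sup>2 * w k k else 0 else 0)
          = t\<^sup>2 * w k k"
        using fin k by (subst sum.swap) simp
      ultimately show ?thesis
        using fin k by (simp add: sum.distrib quad_def)
    qed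
    also have "(\<Sum>i\<in>I. t * (w i k * x i)) = (\<Sum>j\<in>I. t * (w k j * x j))"
      by (intro sum.cong refl) (metis sym)
    finally show ?thesis by (simp add: sum_distrib_left mult_ac)
  qed
  have expand_norm: "(\<Sum>i\<in>I. (x i + (if i = k then t else 0))\<^sup>2)
      = (\<Sum>i\<in>I. (x i)\<^sup>2) + 2 * t * x k + t\<^sup>2" for t
  proof -
    have "(\<Sum>i\<in>I. (x i + (if i = k then t else 0))\<^sup>2)
        = (\<Sum>i\<in>I. (x i)\<^sup>2 + (if i = k then 2 * t * x k + t\<^sup>2 else 0))"
      by (intro sum.cong refl) (auto simp: power2_sum)
    then show ?thesis using fin k by (simp add: sum.distrib)
  qed
  have ineq: "0 \<le> 2 * t * g + t\<^sup>2 * c" for t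
    using lower[of "\<lambda>i. x i + (if i = k then t else 0)"] attained
    unfolding expand expand_norm g_def c_def by (simp add: algebra_simps)
  \<comment> \<open>A step so short that the quadratic term \<open>t\<^sup>2 c\<close> cannot outweigh half of the linear one.\<close>
  define s where "s = 1 / (1 + \<bar>c\<bar>)"
  have s: "s > 0" "s * c \<le> 1"
    by (auto simp: s_def divide_simps)
  have "0 \<le> s * (g\<^sup>2 * (s * c - 2))"
    using ineq[of "- s * g"] by (simp add: algebra_simps power2_eq_square)
  then have "0 \<le> g\<^sup>2 * (s * c - 2)"
    using s(1) by (simp add: zero_le_mult_iff)
  then have "g = 0"
    using s(2) by (auto simp: zero_le_mult_iff)
  then show ?thesis by (simp add: g_def)
qed

text \<open>
  Variational existence of a least eigenvector. As the dimension is the size of a set and not of a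
  type, the unit sphere is realised in the function space \<open>'i \<Rightarrow> real\<close> with its product topology, where
  it is a closed subset of a Tychonoff cube.
\<close>

lemma rayleigh_minimum:
  fixes w :: "'i \<Rightarrow> 'i \<Rightarrow> real"
  assumes fin: "finite I" and ne: "I \<noteq> {}" and sym: "\<And>i j. w i j = w j i"
  obtains x \<mu> where "(\<Sum>i\<in>I. (x i)\<^sup>2) = 1"
    and "\<And>i. i \<in> I \<Longrightarrow> (\<Sum>j\<in>I. w i j * x j) = \<mu> * x i"
    and "\<And>y. \<mu> * (\<Sum>i\<in>I. (y i)\<^sup>2) \<le> quad I w y"
proof -
  \<comment> \<open>Coordinates outside \<open>I\<close> are pinned to \<open>0\<close>, without which the sphere would not be compact.\<close>
  define C where "C = (\<Pi>\<^sub>E i\<in>UNIV. if i \<in> I then {-1..1::real} else {0})"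
  define K where "K = C \<inter> {f. (\<Sum>i\<in>I. (f i)\<^sup>2) = 1}"
  have "compactin (product_topology (\<lambda>i::'i. euclidean::real topology) UNIV) C"
    unfolding C_def compactin_PiE by auto
  then have "compact C"
    by (simp add: euclidean_product_topology)
  have "closed {f::'i \<Rightarrow> real. (\<Sum>i\<in>I. (f i)\<^sup>2) = 1}"
    by (intro closed_Collect_eq continuous_intros continuous_on_product_coordinates)
  with \<open>compact C\<close> have K: "compact K"
    unfolding K_def by blast
  obtain k where k: "k \<in> I" using ne by blast
  have "(\<lambda>i. if i = k then 1 else 0) \<in> K"
    using fin k by (auto simp: K_def C_def if_distrib[of "\<lambda>z. z\<^sup>2"] cong: if_cong)
  then have "K \<noteq> {}" by blast
  moreover have "continuous_on K (quad I w)"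
    unfolding quad_def
    by (intro continuous_intros continuous_on_subset[OF continuous_on_product_coordinates]) auto
  ultimately obtain x where x: "x \<in> K" and min: "\<And>y. y \<in> K \<Longrightarrow> quad I w x \<le> quad I w y"
    using continuous_attains_inf[OF K] by blast
  define \<mu> where "\<mu> = quad I w x"
  have unit: "(\<Sum>i\<in>I. (x i)\<^sup>2) = 1" using x by (simp add: K_def)
  have lower: "\<mu> * (\<Sum>i\<in>I. (y i)\<^sup>2) \<le> quad I w y" for y
  proof (cases "(\<Sum>i\<in>I. (y i)\<^sup>2) = 0")
    case True
    then have "\<And>i. i \<in> I \<Longrightarrow> y i = 0"
      using fin by (simp add: sum_nonneg_eq_0_iff)
    then have "quad I w y = 0" by (simp add: quad_def)
    with True show ?thesis by simp
  next
    case False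
    define r where "r = sqrt (\<Sum>i\<in>I. (y i)\<^sup>2)"
    have r2: "r\<^sup>2 = (\<Sum>i\<in>I. (y i)\<^sup>2)" by (simp add: r_def sum_nonneg)
    have "r > 0" using False by (simp add: r_def sum_nonneg order_less_le)
    define z where "z = (\<lambda>i. if i \<in> I then y i / r else 0)"
    have "(y i)\<^sup>2 \<le> r\<^sup>2" if "i \<in> I" for i
      unfolding r2 using fin that by (intro member_le_sum) auto
    then have "\<bar>y i\<bar> \<le> r" if "i \<in> I" for i
      using that \<open>r > 0\<close> abs_le_square_iff[of "y i" r] by auto
    then have "z \<in> C"
      using \<open>r > 0\<close> by (auto simp: C_def z_def divide_simps abs_le_iff minus_le_iff) 
    moreover have "(\<Sum>i\<in>I. (z i)\<^sup>2) = 1"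
      using \<open>r > 0\<close> by (simp add: z_def power_divide sum_divide_distrib[symmetric] r2[symmetric])
    ultimately have "\<mu> \<le> quad I w z"
      unfolding \<mu>_def by (intro min) (simp add: K_def)
    also have "quad I w z = quad I w y / r\<^sup>2"
      by (simp add: quad_def z_def sum_divide_distrib power2_eq_square)
    finally show ?thesis
      using \<open>r > 0\<close> by (simp add: r2[symmetric] divide_simps)
  qed
  show ?thesis
  proof (rule that[of x \<mu>])
    show "(\<Sum>j\<in>I. w i j * x j) = \<mu> * x i" if "i \<in> I" for i
      using minimizer_eigenvector[OF fin sym lower _ that] unit by (simp add: \<mu>_def)
  qed (use unit lower in auto)
qed

text \<open>
  The minimum of the quadratic form is an eigenvalue by \<open>rayleigh_minimum\<close>, and evaluating the form at an
  eigenvector shows that no real eigenvalue lies below it.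
\<close>

lemma least_eigenvalue_rayleigh:
  fixes w :: "'v \<Rightarrow> 'v \<Rightarrow> real"
  assumes "distinct vs" "vs \<noteq> []" and sym: "\<And>u v. w u v = w v u"
  defines "A \<equiv> mat (length vs) (length vs) (\<lambda>(i, j). w (vs ! i) (vs ! j))"
  obtains x where "(\<Sum>v\<in>set vs. (x v)\<^sup>2) = 1"
    and "quad (set vs) w x = least_eigenvalue A"
    and "\<And>y. least_eigenvalue A * (\<Sum>v\<in>set vs. (y v)\<^sup>2) \<le> quad (set vs) w y"
proof -
  let ?n = "length vs"
  have reindex: "(\<Sum>j<?n. f (vs ! j)) = (\<Sum>v\<in>set vs. f v)" for f :: "'v \<Rightarrow> real"
    by (rule sum.reindex_bij_betw[OF bij_betw_nth]) (use assms in auto)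
  have A: "A \<in> carrier_mat ?n ?n" by (simp add: A_def)
  obtain x \<mu> where x: "(\<Sum>v\<in>set vs. (x v)\<^sup>2) = 1"
    and eig: "\<And>u. u \<in> set vs \<Longrightarrow> (\<Sum>v\<in>set vs. w u v * x v) = \<mu> * x u"
    and lower: "\<And>y. \<mu> * (\<Sum>v\<in>set vs. (y v)\<^sup>2) \<le> quad (set vs) w y"
    by (rule rayleigh_minimum[of "set vs" w, OF _ _ sym]) (use \<open>vs \<noteq> []\<close> in auto)
  have "eigenvector A (vec ?n (\<lambda>i. x (vs ! i))) \<mu>"
    unfolding eigenvector_def
  proof (intro conjI)
    show "vec ?n (\<lambda>i. x (vs ! i)) \<noteq> 0\<^sub>v (dim_row A)"
    proof
      assume "vec ?n (\<lambda>i. x (vs ! i)) = 0\<^sub>v (dim_row A)"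
      then have "x (vs ! i) = 0" if "i < ?n" for i
        using that A by (metis carrier_matD(1) index_vec index_zero_vec(1))
      then have "\<forall>v\<in>set vs. x v = 0" by (metis in_set_conv_nth)
      with x show False by simp
    qed
    show "A *\<^sub>v vec ?n (\<lambda>i. x (vs ! i)) = \<mu> \<cdot>\<^sub>v vec ?n (\<lambda>i. x (vs ! i))"
    proof (rule eq_vecI)
      fix i assume "i < dim_vec (\<mu> \<cdot>\<^sub>v vec ?n (\<lambda>i. x (vs ! i)))"
      then have i: "i < ?n" by simp
      have "(\<Sum>j<?n. w (vs ! i) (vs ! j) * x (vs ! j)) = \<mu> * x (vs ! i)"
        using reindex[of "\<lambda>v. w (vs ! i) v * x v"] eig[of "vs ! i"] i by simp
      then show "(A *\<^sub>v vec ?n (\<lambda>i. x (vs ! i))) $ i = (\<mu> \<cdot>\<^sub>v vec ?n (\<lambda>i. x (vs ! i))) $ i"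
        using i by (simp add: A_def scalar_prod_def lessThan_atLeast0)
    qed (simp add: A_def)
  qed (simp add: A_def)
  then have mem: "\<mu> \<in> spectrum A" by (auto simp: spectrum_def eigenvalue_def)
  have least: "\<mu> \<le> k" if k: "k \<in> spectrum A" for k
  proof -
    obtain v where v: "v \<in> carrier_vec ?n" "v \<noteq> 0\<^sub>v ?n" "A *\<^sub>v v = k \<cdot>\<^sub>v v"
      using k A by (auto simp: spectrum_def eigenvalue_def eigenvector_def)
    define y where "y u = v $ (the_inv_into {..<?n} ((!) vs) u)" for u
    have y: "y (vs ! i) = v $ i" if "i < ?n" for i
      unfolding y_def using \<open>distinct vs\<close> that
      by (subst the_inv_into_f_f) (auto simp: inj_on_def nth_eq_iff_index_eq)
    have "(\<Sum>s\<in>set vs. w u s * y s) = k * y u" if u: "u \<in> set vs" for u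
    proof -
      obtain i where i: "i < ?n" "u = vs ! i" using u by (metis in_set_conv_nth)
      have "(\<Sum>s\<in>set vs. w u s * y s) = (\<Sum>j<?n. w u (vs ! j) * y (vs ! j))"
        by (rule reindex[symmetric])
      also have "\<dots> = (\<Sum>j<?n. w u (vs ! j) * v $ j)" using y by simp
      also have "\<dots> = (A *\<^sub>v v) $ i"
        using i v(1) by (simp add: A_def scalar_prod_def lessThan_atLeast0)
      also have "\<dots> = k * y u" using v i y by simp
      finally show ?thesis .
    qed
    then have "\<mu> * (\<Sum>s\<in>set vs. (y s)\<^sup>2) \<le> k * (\<Sum>s\<in>set vs. (y s)\<^sup>2)"
      using lower[of y] quad_eigenvector[of "set vs" w y k] by simp
    moreover have "(\<Sum>s\<in>set vs. (y s)\<^sup>2) > 0"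
    proof -
      obtain i where i: "i < ?n" "v $ i \<noteq> 0"
        using v(1,2) by (metis carrier_vecD eq_vecI index_zero_vec)
      have "0 < (y (vs ! i))\<^sup>2" using i y by simp
      also have "\<dots> \<le> (\<Sum>s\<in>set vs. (y s)\<^sup>2)"
        by (rule member_le_sum) (use i in auto)
      finally show ?thesis .
    qed
    ultimately show ?thesis by simp
  qed
  have "least_eigenvalue A = \<mu>"
    unfolding least_eigenvalue_def
    using card_finite_spectrum(1)[OF A] mem least by (intro Min_eqI) auto
  then show ?thesis
    using that[of x] x lower quad_eigenvector[of "set vs" w x \<mu>] eig by simp
qed

section \<open>The quadratic form of an unsigned graph\<close>

definition adj :: "'v set set \<Rightarrow> 'v \<Rightarrow> 'v \<Rightarrow> real" where
  "adj E u v = (if {u, v} \<in> E then 1 else 0)"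

lemma adj_commute: "adj E u v = adj E v u"
  by (simp add: adj_def insert_commute)

lemma adj_nonneg [simp]: "0 \<le> adj E u v"
  by (simp add: adj_def)

lemma quad_adj_abs: "quad V (adj E) x \<le> quad V (adj E) (\<lambda>v. \<bar>x v\<bar>)"
  unfolding quad_def by (intro sum_mono) (simp add: adj_def abs_mult[symmetric] abs_ge_self)

text \<open>
  The bound of Hong, Shu and Fang for the spectral radius of a graph with \<open>n\<close> vertices, \<open>m\<close> edges and
  minimum degree \<open>d\<close>. It is the larger root of \<open>t\<^sup>2 - (d - 1) t = 2 m - (n - 1) d\<close>.
\<close>

definition hsf_bound :: "nat \<Rightarrow> nat \<Rightarrow> nat \<Rightarrow> real" where
  "hsf_bound n m d = (real d - 1) / 2 + sqrt (2 * real m - real n * real d + (1 + real d)\<^sup>2 / 4)"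

context simple_graph
begin

lemma edgeE:
  assumes "e \<in> E"
  obtains u v where "e = {u, v}" "u \<in> V" "v \<in> V" "u \<noteq> v"
  using assms edges_subset by blast

lemma finite_edges: "finite E"
proof (rule finite_subset)
  show "E \<subseteq> Pow V" by (auto elim!: edgeE)
qed (simp add: finite_vertices)

lemma adj_self [simp]: "adj E u u = 0"
  unfolding adj_def by (auto elim!: edgeE simp: doubleton_eq_iff)

lemma vertex_degree_eq_sum_adj:
  assumes "u \<in> V"
  shows "real (vertex_degree E u) = (\<Sum>v\<in>V. adj E u v)"
proof -
  have "{e \<in> E. u \<in> e} = (\<lambda>v. {u, v}) ` {v \<in> V. {u, v} \<in> E}"
  proof (intro equalityI subsetI)
    fix e assume e: "e \<in> {e \<in> E. u \<in> e}"
    then obtain a b where "e = {a, b}" "a \<in> V" "b \<in> V" by (auto elim: edgeE)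
    with e consider "e = {u, b}" "b \<in> V" | "e = {u, a}" "a \<in> V" by blast
    then show "e \<in> (\<lambda>v. {u, v}) ` {v \<in> V. {u, v} \<in> E}"
      using e by cases auto
  qed auto
  moreover have "inj_on (\<lambda>v. {u, v}) {v \<in> V. {u, v} \<in> E}"
    by (auto simp: inj_on_def doubleton_eq_iff)
  ultimately have "vertex_degree E u = card {v \<in> V. {u, v} \<in> E}"
    by (simp add: vertex_degree_def card_image)
  then show ?thesis
    by (simp add: adj_def sum.If_cases finite_vertices Int_def)
qed

lemma sum_vertex_degree: "(\<Sum>v\<in>V. real (vertex_degree E v)) = 2 * real (card E)"
proof -
  have "(\<Sum>v\<in>V. real (vertex_degree E v)) = (\<Sum>v\<in>V. \<Sum>e\<in>E. if v \<in> e then 1 else 0)"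
    by (simp add: vertex_degree_def sum.If_cases finite_edges Int_def)
  also have "\<dots> = (\<Sum>e\<in>E. \<Sum>v\<in>V. if v \<in> e then 1 else 0)"
    by (rule sum.swap)
  also have "\<dots> = (\<Sum>e\<in>E. 2)"
  proof (rule sum.cong[OF refl])
    fix e assume "e \<in> E"
    then obtain u v where uv: "e = {u, v}" "u \<in> V" "v \<in> V" "u \<noteq> v" by (rule edgeE)
    then have "V \<inter> e = {u, v}" by auto
    with uv show "(\<Sum>v\<in>V. if v \<in> e then 1 else 0) = (2::real)"
      by (simp add: sum.If_cases finite_vertices Int_def)
  qed
  finally show ?thesis by simp
qed

text \<open>
  The left side is the row sum at \<open>u\<close> of \<open>H\<^sup>2 - (d - 1) H\<close>, with \<open>H\<close> the adjacency matrix. The degrees of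
  the neighbours of \<open>u\<close> are counted as the total degree minus those of \<open>u\<close> and of its non-neighbours;
  splitting each of the latter into \<open>d\<close> and an excess over \<open>d\<close> makes the degree of \<open>u\<close> cancel.
\<close>

lemma row_sum_identity:
  fixes d :: real
  assumes u: "u \<in> V"
  shows "(\<Sum>v\<in>V. adj E u v * real (vertex_degree E v)) - (d - 1) * real (vertex_degree E u)
    = 2 * real (card E) - (real (card V) - 1) * d
      - (\<Sum>v\<in>V - {u}. (1 - adj E u v) * (real (vertex_degree E v) - d))"
proof -
  have split: "(\<Sum>v\<in>V. f v) = f u + (\<Sum>v\<in>V - {u}. f v)" for f :: "'v \<Rightarrow> real"
    using u finite_vertices by (rule sum.remove[rotated])
  have "real (card (V - {u})) = real (card V) - 1"
    using u finite_vertices card_gt_0_iff[of V] by (auto simp: of_nat_diff Suc_leI)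
  then have "(\<Sum>v\<in>V - {u}. (1 - adj E u v) * (real (vertex_degree E v) - d))
      = (\<Sum>v\<in>V - {u}. real (vertex_degree E v)) - (real (card V) - 1) * d
        - (\<Sum>v\<in>V - {u}. adj E u v * real (vertex_degree E v)) + d * (\<Sum>v\<in>V - {u}. adj E u v)"
    by (simp only: left_diff_distrib right_diff_distrib sum_subtractf sum_distrib_left
        sum_constant mult_1 mult.commute[of _ d] of_nat_mult) (simp add: algebra_simps)
  with split[of "\<lambda>v. real (vertex_degree E v)"] split[of "adj E u"]
    split[of "\<lambda>v. adj E u v * real (vertex_degree E v)"]
  show ?thesis
    using vertex_degree_eq_sum_adj[OF u] sum_vertex_degree by (simp add: algebra_simps)
qed

text \<open>
  The sum of the entries of \<open>(H\<^sup>2 - (d - 1) H) y\<close>, evaluated once through the eigenvector equation and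
  once, by symmetry of \<open>H\<close>, through the row sums. When \<open>d\<close> is the minimum degree and \<open>y \<ge> 0\<close>, all terms
  on the right are excesses of one sign, which yields both the bound on \<open>\<rho>\<close> and its equality case.
\<close>

lemma eigenvector_row_sums:
  fixes d :: real
  assumes eig: "\<And>u. u \<in> V \<Longrightarrow> (\<Sum>v\<in>V. adj E u v * y v) = \<rho> * y u"
  shows "(\<rho>\<^sup>2 - (d - 1) * \<rho> - (2 * real (card E) - (real (card V) - 1) * d)) * (\<Sum>u\<in>V. y u)
    = - (\<Sum>u\<in>V. \<Sum>v\<in>V - {u}. y u * ((1 - adj E u v) * (real (vertex_degree E v) - d)))"
proof -
  let ?deg = "\<lambda>v. real (vertex_degree E v)"
  have "(\<Sum>u\<in>V. ?deg u * y u) = (\<Sum>u\<in>V. \<Sum>v\<in>V. adj E u v * y u)"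
    by (intro sum.cong refl) (simp add: vertex_degree_eq_sum_adj sum_distrib_right)
  also have "\<dots> = (\<Sum>v\<in>V. \<Sum>u\<in>V. adj E v u * y u)"
    by (subst sum.swap) (simp add: adj_commute[of E])
  also have "\<dots> = \<rho> * (\<Sum>u\<in>V. y u)"
    by (simp add: eig sum_distrib_left)
  finally have one: "(\<Sum>u\<in>V. ?deg u * y u) = \<rho> * (\<Sum>u\<in>V. y u)" .
  have "(\<Sum>u\<in>V. y u * (\<Sum>v\<in>V. adj E u v * ?deg v)) = (\<Sum>v\<in>V. ?deg v * (\<Sum>u\<in>V. adj E v u * y u))"
    by (subst (1 2) sum_distrib_left, subst sum.swap) (simp add: mult_ac adj_commute[of E])
  also have "\<dots> = \<rho> * (\<Sum>u\<in>V. ?deg u * y u)"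
    by (subst sum_distrib_left) (intro sum.cong refl, simp add: eig)
  finally have two: "(\<Sum>u\<in>V. y u * (\<Sum>v\<in>V. adj E u v * ?deg v)) = \<rho>\<^sup>2 * (\<Sum>u\<in>V. y u)"
    by (simp add: one power2_eq_square)
  have "(\<rho>\<^sup>2 - (d - 1) * \<rho>) * (\<Sum>u\<in>V. y u)
      = (\<Sum>u\<in>V. y u * (\<Sum>v\<in>V. adj E u v * ?deg v)) - (d - 1) * (\<Sum>u\<in>V. ?deg u * y u)"
    unfolding one two by (simp add: algebra_simps)
  also have "\<dots> = (\<Sum>u\<in>V. y u * ((\<Sum>v\<in>V. adj E u v * ?deg v) - (d - 1) * ?deg u))"
    by (simp add: sum_distrib_left sum_subtractf[symmetric] algebra_simps)
  also have "\<dots> = (\<Sum>u\<in>V. y u * (2 * real (card E) - (real (card V) - 1) * d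
      - (\<Sum>v\<in>V - {u}. (1 - adj E u v) * (?deg v - d))))"
    by (intro sum.cong refl) (simp only: row_sum_identity)
  also have "\<dots> = (2 * real (card E) - (real (card V) - 1) * d) * (\<Sum>u\<in>V. y u)
      - (\<Sum>u\<in>V. \<Sum>v\<in>V - {u}. y u * ((1 - adj E u v) * (?deg v - d)))"
    by (simp only: right_diff_distrib[of "y _" "2 * real (card E) - (real (card V) - 1) * d"]
        sum_subtractf sum_distrib_left mult.commute[of "2 * real (card E) - (real (card V) - 1) * d"])
  finally show ?thesis by (simp add: algebra_simps)
qed

lemma min_degree_le: "v \<in> V \<Longrightarrow> min_degree V E \<le> vertex_degree E v"
  unfolding min_degree_def using finite_vertices by (intro Min_le) auto

lemma min_degree_handshake: "real (card V) * real (min_degree V E) \<le> 2 * real (card E)"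
proof -
  have "(\<Sum>v\<in>V. real (min_degree V E)) \<le> (\<Sum>v\<in>V. real (vertex_degree E v))"
    by (intro sum_mono) (simp add: min_degree_le)
  then show ?thesis by (simp add: sum_vertex_degree)
qed

lemma degree_excess_nonneg:
  assumes "\<And>u. u \<in> V \<Longrightarrow> 0 \<le> y u" "u \<in> V" "v \<in> V - {u}"
  shows "0 \<le> y u * ((1 - adj E u v) * (real (vertex_degree E v) - real (min_degree V E)))"
  using assms min_degree_le[of v] by (auto simp: adj_def)

text \<open>
  The absolute values of a maximizing vector maximize as well, since all weights are nonnegative. So
  the largest eigenvalue has a nonnegative eigenvector, even for a disconnected graph.
\<close>

lemma quad_adj_le:
  assumes ne: "V \<noteq> {}"
  shows "quad V (adj E) z \<le> hsf_bound (card V) (card E) (min_degree V E) * (\<Sum>v\<in>V. (z v)\<^sup>2)"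
proof -
  define d where "d = min_degree V E"
  define D where "D = 2 * real (card E) - real (card V) * real d + (1 + real d)\<^sup>2 / 4"
  have "D \<ge> 0"
    using min_degree_handshake by (simp add: D_def d_def)
  obtain x \<mu> where x: "(\<Sum>v\<in>V. (x v)\<^sup>2) = 1"
    and eig: "\<And>u. u \<in> V \<Longrightarrow> (\<Sum>v\<in>V. - adj E u v * x v) = \<mu> * x u"
    and lower: "\<And>y. \<mu> * (\<Sum>v\<in>V. (y v)\<^sup>2) \<le> quad V (\<lambda>u v. - adj E u v) y"
    by (rule rayleigh_minimum[of V "\<lambda>u v. - adj E u v"])
      (use finite_vertices ne in \<open>auto simp: adj_commute[of E]\<close>)
  define \<rho> where "\<rho> = - \<mu>"
  define y where "y = (\<lambda>v. \<bar>x v\<bar>)"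
  have y: "(\<Sum>v\<in>V. (y v)\<^sup>2) = 1" using x by (simp add: y_def)
  have "quad V (\<lambda>u v. - adj E u v) x = \<mu>"
    using quad_eigenvector[of V "\<lambda>u v. - adj E u v" x \<mu>] eig x by simp
  then have "quad V (\<lambda>u v. - adj E u v) y = \<mu>"
    using lower[of y] quad_adj_abs[of V E x] y by (simp add: quad_uminus y_def)
  then have "(\<Sum>v\<in>V. - adj E u v * y v) = \<mu> * y u" if "u \<in> V" for u
    using minimizer_eigenvector[OF finite_vertices _ lower _ that, of y] y
    by (simp add: adj_commute[of E])
  then have "(\<Sum>v\<in>V. adj E u v * y v) = \<rho> * y u" if "u \<in> V" for u
    using that by (simp add: \<rho>_def sum_negf minus_equation_iff)
  note eig_y = this
  have "0 \<le> (\<Sum>u\<in>V. \<Sum>v\<in>V - {u}. y u * ((1 - adj E u v) * (real (vertex_degree E v) - real d)))"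
    unfolding d_def by (intro sum_nonneg degree_excess_nonneg) (simp_all add: y_def)
  with eigenvector_row_sums[OF eig_y, of "real d"]
  have "(\<rho>\<^sup>2 - (real d - 1) * \<rho> - (2 * real (card E) - (real (card V) - 1) * real d)) * (\<Sum>u\<in>V. y u)
      \<le> 0"
    by simp
  moreover have "(\<Sum>u\<in>V. y u) > 0"
  proof -
    have "(\<Sum>u\<in>V. y u) \<noteq> 0"
    proof
      assume "(\<Sum>u\<in>V. y u) = 0"
      then have "\<forall>u\<in>V. y u = 0"
        using finite_vertices by (simp add: y_def sum_nonneg_eq_0_iff)
      with y show False by simp
    qed
    moreover have "(\<Sum>u\<in>V. y u) \<ge> 0" by (simp add: y_def sum_nonneg)
    ultimately show ?thesis by simp
  qed
  ultimately have "\<rho>\<^sup>2 - (real d - 1) * \<rho> - (2 * real (card E) - (real (card V) - 1) * real d) \<le> 0"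
    by (simp add: mult_le_0_iff)
  then have "(\<rho> - (real d - 1) / 2)\<^sup>2 \<le> D"
    by (simp add: D_def field_simps power2_eq_square)
  then have "\<rho> - (real d - 1) / 2 \<le> sqrt D"
    by (rule real_le_rsqrt)
  then have "\<rho> \<le> hsf_bound (card V) (card E) d"
    by (simp add: hsf_bound_def D_def)
  then have "\<rho> * (\<Sum>v\<in>V. (z v)\<^sup>2) \<le> hsf_bound (card V) (card E) d * (\<Sum>v\<in>V. (z v)\<^sup>2)"
    by (intro mult_right_mono sum_nonneg) auto
  with lower[of z] show ?thesis
    by (simp add: quad_uminus \<rho>_def d_def)
qed

lemma quad_adj_eq_eigenvector:
  assumes "V \<noteq> {}"
    and "quad V (adj E) x = hsf_bound (card V) (card E) (min_degree V E) * (\<Sum>v\<in>V. (x v)\<^sup>2)"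
    and "u \<in> V"
  shows "(\<Sum>v\<in>V. adj E u v * x v) = hsf_bound (card V) (card E) (min_degree V E) * x u"
proof -
  have "(\<Sum>v\<in>V. - adj E u v * x v) = - hsf_bound (card V) (card E) (min_degree V E) * x u"
    by (rule minimizer_eigenvector[of V])
      (use finite_vertices quad_adj_le assms in \<open>auto simp: quad_uminus adj_commute[of E]\<close>)
  then show ?thesis by (simp add: sum_negf)
qed

text \<open>
  If the bound is attained then it is an eigenvalue and a root of the quadratic polynomial, so every
  excess term in \<open>eigenvector_row_sums\<close> vanishes.
\<close>

lemma quad_adj_eq_degree:
  assumes ne: "V \<noteq> {}" and nonneg: "\<And>u. u \<in> V \<Longrightarrow> 0 \<le> y u"
    and eq: "quad V (adj E) y = hsf_bound (card V) (card E) (min_degree V E) * (\<Sum>v\<in>V. (y v)\<^sup>2)"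
    and uv: "u \<in> V" "v \<in> V" "u \<noteq> v" "0 < y u" "{u, v} \<notin> E"
  shows "vertex_degree E v = min_degree V E"
proof -
  define d where "d = min_degree V E"
  define D where "D = 2 * real (card E) - real (card V) * real d + (1 + real d)\<^sup>2 / 4"
  define \<rho> where "\<rho> = hsf_bound (card V) (card E) d"
  have "D \<ge> 0"
    using min_degree_handshake by (simp add: D_def d_def)
  then have "(\<rho> - (real d - 1) / 2)\<^sup>2 = D"
    by (simp add: \<rho>_def hsf_bound_def D_def[symmetric])
  then have "\<rho>\<^sup>2 - (real d - 1) * \<rho> - (2 * real (card E) - (real (card V) - 1) * real d) = 0"
    by (simp add: D_def field_simps power2_eq_square)
  with eigenvector_row_sums[OF quad_adj_eq_eigenvector[OF ne eq], of "real d"]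
  have "(\<Sum>u\<in>V. \<Sum>v\<in>V - {u}. y u * ((1 - adj E u v) * (real (vertex_degree E v) - real d))) = 0"
    by (simp add: \<rho>_def d_def)
  then have "(\<Sum>v\<in>V - {u}. y u * ((1 - adj E u v) * (real (vertex_degree E v) - real d))) = 0"
    using degree_excess_nonneg[of y] nonneg uv(1) finite_vertices
    by (subst (asm) sum_nonneg_eq_0_iff) (auto simp: d_def intro!: sum_nonneg)
  then have "y u * ((1 - adj E u v) * (real (vertex_degree E v) - real d)) = 0"
    using degree_excess_nonneg[of y] nonneg uv(1-3) finite_vertices
    by (subst (asm) sum_nonneg_eq_0_iff) (auto simp: d_def)
  with uv show ?thesis by (simp add: adj_def d_def)
qed

end

section \<open>The lower bound by the largest cut\<close>

context simple_graph
begin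

text \<open>
  The number of edges of a largest cut, because the edges that survive when a graph is made bipartite
  are exactly the edges of some cut.
\<close>

abbreviation max_cut :: real where
  "max_cut \<equiv> real (card E) - real (edge_bipartiteness V E)"

lemma sum_adj_cut_le:
  assumes V: "P \<union> N = V" and disj: "P \<inter> N = {}"
  shows "(\<Sum>u\<in>P. \<Sum>v\<in>N. adj E u v) \<le> max_cut"
proof -
  have fin: "finite P" "finite N" using V finite_vertices by auto
  define C where "C = {e \<in> E. \<exists>a\<in>P. \<exists>b\<in>N. e = {a, b}}"
  have C: "C \<subseteq> E" by (auto simp: C_def)
  have "bipartite V (E - (E - C))"
    unfolding bipartite_def using V disj
    by (intro exI[of _ P] exI[of _ N]) (auto simp: C_def)
  then have "edge_bipartiteness V E \<le> card (E - C)"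
    unfolding edge_bipartiteness_def using finite_edges by (intro Min_le) auto
  moreover have "card (E - C) + card C = card E"
    using C finite_edges by (metis card_Diff_subset card_mono finite_subset le_add_diff_inverse2)
  moreover have "(\<Sum>u\<in>P. \<Sum>v\<in>N. adj E u v) = real (card C)"
  proof -
    have "C = (\<lambda>(a, b). {a, b}) ` {p \<in> P \<times> N. {fst p, snd p} \<in> E}"
      by (force simp: C_def image_iff)
    moreover have "inj_on (\<lambda>(a, b). {a, b}) {p \<in> P \<times> N. {fst p, snd p} \<in> E}"
      using disj by (auto simp: inj_on_def doubleton_eq_iff)
    ultimately have "card C = card {p \<in> P \<times> N. {fst p, snd p} \<in> E}"
      by (simp add: card_image)
    moreover have "(\<Sum>u\<in>P. \<Sum>v\<in>N. adj E u v) = (\<Sum>p\<in>P \<times> N. if {fst p, snd p} \<in> E then 1 else 0)"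
      by (simp add: sum.cartesian_product adj_def case_prod_beta)
    ultimately show ?thesis
      using fin by (simp add: sum.If_cases Int_def)
  qed
  ultimately show ?thesis by linarith
qed

text \<open>
  With \<open>\<kappa>\<^sup>2 = max_cut\<close>, expanding \<open>\<Sum> (adj u v + 2 \<kappa> x u x v)\<^sup>2 \<ge> 0\<close> over the pairs of \<open>P \<times> N\<close> is the
  Cauchy-Schwarz inequality in a form that also shows what equality means. Vertices with \<open>x v = 0\<close> may
  be placed on either side, and varying this choice gives the most from the equality case.
\<close>

lemma quad_adj_ge_sqrt_cut:
  fixes P N :: "'v set" and x :: "'v \<Rightarrow> real"
  assumes V: "P \<union> N = V" and disj: "P \<inter> N = {}"
    and unit: "(\<Sum>v\<in>V. (x v)\<^sup>2) = 1"
    and P: "\<And>v. v \<in> P \<Longrightarrow> 0 \<le> x v" and N: "\<And>v. v \<in> N \<Longrightarrow> x v \<le> 0"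
  shows "- sqrt max_cut \<le> quad V (adj E) x"
    and "quad V (adj E) x = - sqrt max_cut \<Longrightarrow> u \<in> P \<Longrightarrow> v \<in> N
      \<Longrightarrow> adj E u v = - 2 * sqrt max_cut * x u * x v"
    and "quad V (adj E) x = - sqrt max_cut \<Longrightarrow> u \<in> P \<Longrightarrow> v \<in> P
      \<Longrightarrow> adj E u v * x u * x v = 0"
    and "quad V (adj E) x = - sqrt max_cut \<Longrightarrow> u \<in> N \<Longrightarrow> v \<in> N
      \<Longrightarrow> adj E u v * x u * x v = 0"
proof -
  have fin: "finite P" "finite N" using V finite_vertices by auto
  define c where "c = (\<Sum>u\<in>P. \<Sum>v\<in>N. adj E u v)"
  define \<kappa> where "\<kappa> = sqrt max_cut"
  have "0 \<le> c" by (simp add: c_def sum_nonneg)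
  moreover have "c \<le> max_cut"
    unfolding c_def by (rule sum_adj_cut_le[OF V disj])
  ultimately have \<kappa>: "0 \<le> \<kappa>" "c \<le> \<kappa>\<^sup>2" by (simp_all add: \<kappa>_def)
  define T where "T = (\<Sum>u\<in>P. \<Sum>v\<in>N. adj E u v * x u * x v)"
  define PP where "PP = (\<Sum>u\<in>P. \<Sum>v\<in>P. adj E u v * x u * x v)"
  define NN where "NN = (\<Sum>u\<in>N. \<Sum>v\<in>N. adj E u v * x u * x v)"
  define p where "p = (\<Sum>u\<in>P. (x u)\<^sup>2)"
  define q where "q = (\<Sum>v\<in>N. (x v)\<^sup>2)"
  have split: "(\<Sum>v\<in>V. f v) = (\<Sum>v\<in>P. f v) + (\<Sum>v\<in>N. f v)" for f :: "'v \<Rightarrow> real"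
    unfolding V[symmetric] using fin disj by (rule sum.union_disjoint)
  have "(\<Sum>u\<in>N. \<Sum>v\<in>P. adj E u v * x u * x v) = T"
    unfolding T_def by (subst sum.swap) (simp add: adj_commute[of E] mult_ac)
  then have quad: "quad V (adj E) x = PP + NN + 2 * T"
    unfolding quad_def split sum.distrib by (simp add: PP_def NN_def T_def)
  have PP_term: "0 \<le> adj E u v * x u * x v" if "u \<in> P" "v \<in> P" for u v
    using that P by simp
  have NN_term: "0 \<le> adj E u v * x u * x v" if "u \<in> N" "v \<in> N" for u v
    using that N by (simp add: mult.assoc mult_nonpos_nonpos)
  have PP: "0 \<le> PP" and NN: "0 \<le> NN"
    unfolding PP_def NN_def by (intro sum_nonneg PP_term NN_term; simp)+
  define S where "S = (\<Sum>u\<in>P. \<Sum>v\<in>N. (adj E u v + 2 * \<kappa> * x u * x v)\<^sup>2)"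
  have "S = (\<Sum>u\<in>P. \<Sum>v\<in>N. adj E u v + 4 * \<kappa> * (adj E u v * x u * x v)
      + 4 * \<kappa>\<^sup>2 * ((x u)\<^sup>2 * (x v)\<^sup>2))"
    unfolding S_def
    by (intro sum.cong refl) (simp add: adj_def power2_eq_square algebra_simps)
  also have "\<dots> = c + 4 * \<kappa> * T + 4 * \<kappa>\<^sup>2 * (p * q)"
    by (simp add: sum.distrib c_def T_def p_def q_def sum_distrib_left[symmetric] sum_product)
  finally have S: "S = c + 4 * \<kappa> * T + 4 * \<kappa>\<^sup>2 * (p * q)" .
  \<comment> \<open>\<open>4 p q \<le> (p + q)\<^sup>2 = 1\<close> bounds the last summand of \<open>S\<close>.\<close>
  have "p + q = 1" using unit by (simp add: split p_def q_def)
  then have "(p + q)\<^sup>2 = 1" by simp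
  then have "4 * (p * q) = 1 - (p - q)\<^sup>2"
    by (simp add: power2_eq_square algebra_simps)
  then have "\<kappa>\<^sup>2 * (4 * (p * q)) \<le> \<kappa>\<^sup>2 * 1"
    by (intro mult_left_mono) auto
  with S \<kappa> have S_le: "S \<le> 2 * \<kappa> * (\<kappa> + 2 * T)"
    by (simp add: power2_eq_square algebra_simps)
  have S_nonneg: "0 \<le> S"
    unfolding S_def by (intro sum_nonneg) auto
  have T: "- \<kappa> \<le> 2 * T"
  proof (cases "\<kappa> = 0")
    case True
    with \<kappa> have "c \<le> 0" by simp
    then have "c = 0" using \<open>0 \<le> c\<close> by simp
    then have "\<forall>u\<in>P. \<forall>v\<in>N. adj E u v = 0"
      using fin by (simp add: c_def sum_nonneg_eq_0_iff sum_nonneg)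
    then have "T = 0" by (simp add: T_def)
    with True show ?thesis by simp
  next
    case False
    with \<kappa> have "0 < \<kappa>" by simp
    moreover have "0 \<le> 2 * \<kappa> * (\<kappa> + 2 * T)" using S_le S_nonneg by linarith
    ultimately have "0 \<le> \<kappa> + 2 * T" by (simp add: zero_le_mult_iff)
    then show ?thesis by simp
  qed
  show "- sqrt max_cut \<le> quad V (adj E) x"
    unfolding \<kappa>_def[symmetric] quad using PP NN T by linarith
  assume "quad V (adj E) x = - sqrt max_cut"
  then have eq: "PP = 0" "NN = 0" "\<kappa> + 2 * T = 0"
    unfolding \<kappa>_def[symmetric] quad using PP NN T by linarith+
  then have "S = 0" using S_le S_nonneg by simp
  show "adj E u v = - 2 * sqrt max_cut * x u * x v"
    if uv: "u \<in> P" "v \<in> N"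
  proof -
    have "(adj E u v + 2 * \<kappa> * x u * x v)\<^sup>2 = 0"
      using \<open>S = 0\<close> fin uv unfolding S_def by (simp add: sum_nonneg_eq_0_iff sum_nonneg)
    then show ?thesis by (simp add: \<kappa>_def)
  qed
  have zero: "f u v = 0"
    if "(\<Sum>u\<in>A. \<Sum>v\<in>A. f u v) = 0" "finite A" "\<And>u v. u \<in> A \<Longrightarrow> v \<in> A \<Longrightarrow> 0 \<le> f u v" "u \<in> A" "v \<in> A"
    for f :: "'v \<Rightarrow> 'v \<Rightarrow> real" and A
    using that by (simp add: sum_nonneg_eq_0_iff sum_nonneg)
  show "adj E u v * x u * x v = 0" if "u \<in> P" "v \<in> P"
    using eq(1) fin(1) PP_term that unfolding PP_def by (rule zero)
  show "adj E u v * x u * x v = 0" if "u \<in> N" "v \<in> N"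
    using eq(2) fin(2) NN_term that unfolding NN_def by (rule zero)
qed

lemma quad_adj_ge:
  assumes "(\<Sum>v\<in>V. (x v)\<^sup>2) = 1"
  shows "- sqrt max_cut \<le> quad V (adj E) x"
  by (rule quad_adj_ge_sqrt_cut(1)[of "{v \<in> V. 0 \<le> x v}" "{v \<in> V. x v < 0}"]) (use assms in auto)

lemma quad_adj_eq_same_sign:
  assumes unit: "(\<Sum>v\<in>V. (x v)\<^sup>2) = 1"
    and eq: "quad V (adj E) x = - sqrt max_cut"
    and uv: "u \<in> V" "v \<in> V" "0 < x u * x v"
  shows "{u, v} \<notin> E"
proof -
  let ?P = "{v \<in> V. 0 \<le> x v}" and ?N = "{v \<in> V. x v < 0}"
  have "adj E u v * x u * x v = 0"
  proof (cases "0 \<le> x u")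
    case True
    with uv have "u \<in> ?P" "v \<in> ?P" by (auto simp: zero_less_mult_iff)
    then show ?thesis by (rule quad_adj_ge_sqrt_cut(3)[of ?P ?N, rotated 6]) (use unit eq in auto)
  next
    case False
    with uv have "u \<in> ?N" "v \<in> ?N" by (auto simp: zero_less_mult_iff)
    then show ?thesis by (rule quad_adj_ge_sqrt_cut(4)[of ?P ?N, rotated 6]) (use unit eq in auto)
  qed
  with uv(3) show ?thesis by (auto simp: adj_def)
qed

text \<open>
  When \<open>u\<close> and \<open>v\<close> both have entry \<open>0\<close>, a cut that separates them is still consistent with the signs of
  \<open>x\<close>; this excludes edges among the zero entries without counting edges.
\<close>

lemma quad_adj_eq_opposite_sign:
  assumes unit: "(\<Sum>v\<in>V. (x v)\<^sup>2) = 1"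
    and eq: "quad V (adj E) x = - sqrt max_cut"
    and uv: "u \<in> V" "v \<in> V" "u \<noteq> v" "0 \<le> x u" "x v \<le> 0"
  shows "adj E u v = - 2 * sqrt max_cut * x u * x v"
proof -
  \<comment> \<open>All vertices with entry \<open>0\<close> other than \<open>u\<close> go to the side of \<open>v\<close>.\<close>
  let ?P = "insert u {v \<in> V. 0 < x v}" and ?N = "{v \<in> V. x v \<le> 0} - {u}"
  have "u \<in> ?P" "v \<in> ?N" using uv by auto
  then show ?thesis
    by (rule quad_adj_ge_sqrt_cut(2)[of ?P ?N, rotated 6]) (use unit eq uv in auto)
qed

lemma one_le_card_minus_edge_bipartiteness:
  assumes "E \<noteq> {}"
  shows "1 \<le> max_cut"
proof -
  obtain u v where uv: "{u, v} \<in> E" "u \<in> V" "v \<in> V" "u \<noteq> v"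
    using assms by (metis edgeE ex_in_conv)
  have "1 = adj E u v" using uv by (simp add: adj_def)
  also have "\<dots> \<le> (\<Sum>w\<in>V - {u}. adj E u w)"
    by (rule member_le_sum) (use uv finite_vertices in auto)
  also have "\<dots> = (\<Sum>s\<in>{u}. \<Sum>w\<in>V - {u}. adj E s w)" by simp
  also have "\<dots> \<le> max_cut"
    by (rule sum_adj_cut_le) (use uv in auto)
  finally show ?thesis .
qed

lemma edge_bipartiteness_bipartite:
  assumes "bipartite V E"
  shows "edge_bipartiteness V E = 0"
proof -
  have "0 \<in> card ` {F. F \<subseteq> E \<and> bipartite V (E - F)}"
    using assms by (auto intro!: image_eqI[of _ _ "{}"])
  then have "edge_bipartiteness V E \<le> 0"
    unfolding edge_bipartiteness_def using finite_edges by (intro Min_le) auto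
  then show ?thesis by simp
qed

end

section \<open>Signed graphs\<close>

lemma doubleton_in_complete_bipartite_edges:
  "{u, v} \<in> complete_bipartite_edges A B \<longleftrightarrow> u \<in> A \<and> v \<in> B \<or> u \<in> B \<and> v \<in> A"
  unfolding complete_bipartite_edges_def mem_Collect_eq doubleton_eq_iff by blast

context signed_graph
begin

lemma simple_graph_pos_edges: "simple_graph V (pos_edges E \<sigma>)"
  by unfold_locales (use finite_vertices edges_subset in \<open>auto simp: pos_edges_def\<close>)

lemma simple_graph_neg_edges: "simple_graph V (neg_edges E \<sigma>)"
  by unfold_locales (use finite_vertices edges_subset in \<open>auto simp: neg_edges_def\<close>)

definition weight :: "'v \<Rightarrow> 'v \<Rightarrow> real" where
  "weight u v = adj (pos_edges E \<sigma>) u v - adj (neg_edges E \<sigma>) u v"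

lemma pos_neg_disjoint: "e \<in> pos_edges E \<sigma> \<Longrightarrow> e \<notin> neg_edges E \<sigma>"
  by (auto simp: pos_edges_def neg_edges_def)

lemma quad_weight:
  "quad V weight x = quad V (adj (pos_edges E \<sigma>)) x - quad V (adj (neg_edges E \<sigma>)) x"
  by (simp add: quad_def weight_def left_diff_distrib sum_subtractf)

lemma adjacency_matrix_weight:
  "adjacency_matrix vs E \<sigma> = mat (length vs) (length vs) (\<lambda>(i, j). weight (vs ! i) (vs ! j))"
  unfolding adjacency_matrix_def
proof (intro cong_mat refl, unfold prod.case)
  fix i j
  show "(if {vs ! i, vs ! j} \<in> E then \<sigma> {vs ! i, vs ! j} else 0) = weight (vs ! i) (vs ! j)"
    using sign_values[of "{vs ! i, vs ! j}"]
    by (auto simp: weight_def adj_def pos_edges_def neg_edges_def)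
qed

definition eigenvalue_bound :: real where
  "eigenvalue_bound =
     - sqrt (real (card (pos_edges E \<sigma>)) - real (edge_bipartiteness V (pos_edges E \<sigma>)))
     - hsf_bound (card V) (card (neg_edges E \<sigma>)) (min_degree V (neg_edges E \<sigma>))"

lemma quad_weight_ge:
  assumes "V \<noteq> {}" and "(\<Sum>v\<in>V. (x v)\<^sup>2) = 1"
  shows "eigenvalue_bound \<le> quad V weight x"
  using simple_graph.quad_adj_ge[OF simple_graph_pos_edges, of x] assms
    simple_graph.quad_adj_le[OF simple_graph_neg_edges, of x]
  by (simp add: quad_weight eigenvalue_bound_def)

definition extremal_partition :: "'v set \<Rightarrow> 'v set \<Rightarrow> 'v set \<Rightarrow> bool" where
  "extremal_partition S1 S2 Z \<longleftrightarrow>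
     V = S1 \<union> S2 \<union> Z \<and> S1 \<inter> S2 = {} \<and> S1 \<inter> Z = {} \<and> S2 \<inter> Z = {}
     \<and> S1 \<noteq> {} \<and> S2 \<noteq> {}
     \<and> pos_edges E \<sigma> = complete_bipartite_edges S1 S2
     \<and> regular_graph V (neg_edges E \<sigma>) (min_degree V (neg_edges E \<sigma>))
     \<and> (\<forall>z\<in>Z. \<forall>s\<in>S1 \<union> S2. {z, s} \<notin> neg_edges E \<sigma>)"

text \<open>
  The partition is by the sign of the entries of \<open>x\<close>. An edge of \<open>H\<close> at a zero entry would lead to a
  neighbour with zero entry because \<open>\<bar>x\<bar>\<close> solves the eigenvector equation of \<open>H\<close> there, which is the
  third condition.
\<close>

lemma extremal_partition_of_minimizer:
  assumes ne: "V \<noteq> {}" and pos: "pos_edges E \<sigma> \<noteq> {}"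
    and unit: "(\<Sum>v\<in>V. (x v)\<^sup>2) = 1" and eq: "quad V weight x = eigenvalue_bound"
  shows "extremal_partition {v \<in> V. 0 < x v} {v \<in> V. x v < 0} {v \<in> V. x v = 0}"
    (is "extremal_partition ?S1 ?S2 ?Z")
proof -
  interpret pos: simple_graph V "pos_edges E \<sigma>" by (rule simple_graph_pos_edges)
  interpret neg: simple_graph V "neg_edges E \<sigma>" by (rule simple_graph_neg_edges)
  define \<kappa> where "\<kappa> = sqrt pos.max_cut"
  define \<delta> where "\<delta> = min_degree V (neg_edges E \<sigma>)"
  define \<Lambda> where "\<Lambda> = hsf_bound (card V) (card (neg_edges E \<sigma>)) \<delta>"
  have "1 \<le> \<kappa>"
    using pos.one_le_card_minus_edge_bipartiteness[OF pos] by (simp add: \<kappa>_def)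
  have "- \<kappa> \<le> quad V (adj (pos_edges E \<sigma>)) x" "quad V (adj (neg_edges E \<sigma>)) x \<le> \<Lambda>"
    using pos.quad_adj_ge[OF unit] neg.quad_adj_le[OF ne, of x] unit
    by (simp_all add: \<kappa>_def \<Lambda>_def \<delta>_def)
  moreover have "quad V (adj (pos_edges E \<sigma>)) x - quad V (adj (neg_edges E \<sigma>)) x = - \<kappa> - \<Lambda>"
    using eq by (simp add: quad_weight eigenvalue_bound_def \<kappa>_def \<Lambda>_def \<delta>_def)
  ultimately have pos_eq: "quad V (adj (pos_edges E \<sigma>)) x = - sqrt pos.max_cut"
    and neg_eq: "quad V (adj (neg_edges E \<sigma>)) x = \<Lambda>"
    by (simp_all add: \<kappa>_def)

  have opposite: "{u, v} \<in> pos_edges E \<sigma> \<longleftrightarrow> x u \<noteq> 0 \<and> x v \<noteq> 0"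
    if "u \<in> V" "v \<in> V" "u \<noteq> v" "0 \<le> x u" "x v \<le> 0" for u v
  proof -
    have "adj (pos_edges E \<sigma>) u v = - 2 * \<kappa> * x u * x v"
      using pos.quad_adj_eq_opposite_sign[OF unit pos_eq that] by (simp add: \<kappa>_def)
    then show ?thesis
      using \<open>1 \<le> \<kappa>\<close> by (auto simp: adj_def split: if_splits)
  qed
  have pos_edge: "x u * x v < 0" if "{u, v} \<in> pos_edges E \<sigma>" for u v
  proof -
    have uv: "u \<in> V" "v \<in> V" "u \<noteq> v"
      using that by (auto elim!: pos.edgeE simp: doubleton_eq_iff)
    have same: "\<not> 0 < x u * x v"
      using pos.quad_adj_eq_same_sign[OF unit pos_eq uv(1,2)] that by blast
    have "0 \<le> x u \<and> x v \<le> 0 \<or> 0 \<le> x v \<and> x u \<le> 0"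
      using same unfolding zero_less_mult_iff by linarith
    then consider "0 \<le> x u" "x v \<le> 0" | "0 \<le> x v" "x u \<le> 0"
      by blast
    then have "x u \<noteq> 0 \<and> x v \<noteq> 0"
      using opposite[of u v] opposite[of v u] uv that by cases (auto simp: insert_commute)
    with same show ?thesis by (auto simp: not_less order_less_le)
  qed
  have C1: "pos_edges E \<sigma> = complete_bipartite_edges ?S1 ?S2"
  proof (intro equalityI subsetI)
    fix e assume e: "e \<in> pos_edges E \<sigma>"
    then obtain u v where uv: "e = {u, v}" "u \<in> V" "v \<in> V" by (rule pos.edgeE)
    from pos_edge[of u v] e uv consider "0 < x u" "x v < 0" | "0 < x v" "x u < 0"
      by (auto simp: mult_less_0_iff)
    then show "e \<in> complete_bipartite_edges ?S1 ?S2"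
      using uv unfolding complete_bipartite_edges_def by cases blast+
  next
    fix e assume "e \<in> complete_bipartite_edges ?S1 ?S2"
    then obtain u v where "e = {u, v}" "u \<in> ?S1" "v \<in> ?S2"
      by (auto simp: complete_bipartite_edges_def)
    moreover from this have "u \<noteq> v" by auto
    ultimately show "e \<in> pos_edges E \<sigma>" using opposite[of u v] by auto
  qed
  have S: "?S1 \<noteq> {}" "?S2 \<noteq> {}"
    using pos unfolding C1 complete_bipartite_edges_def by blast+

  define y where "y = (\<lambda>v. \<bar>x v\<bar>)"
  have "\<Lambda> \<le> quad V (adj (neg_edges E \<sigma>)) y"
    using quad_adj_abs[of V "neg_edges E \<sigma>" x] by (simp add: neg_eq y_def)
  moreover have "quad V (adj (neg_edges E \<sigma>)) y \<le> \<Lambda>"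
    using neg.quad_adj_le[OF ne, of y] unit by (simp add: y_def \<Lambda>_def \<delta>_def)
  ultimately have y_eq: "quad V (adj (neg_edges E \<sigma>)) y
      = hsf_bound (card V) (card (neg_edges E \<sigma>)) (min_degree V (neg_edges E \<sigma>)) * (\<Sum>v\<in>V. (y v)\<^sup>2)"
    using unit by (simp add: y_def \<Lambda>_def \<delta>_def)
  have C3: "{z, s} \<notin> neg_edges E \<sigma>" if "z \<in> ?Z" "s \<in> ?S1 \<union> ?S2" for z s
  proof -
    have "(\<Sum>v\<in>V. adj (neg_edges E \<sigma>) z v * y v) = 0"
      using neg.quad_adj_eq_eigenvector[OF ne y_eq, of z] that(1) by (simp add: y_def)
    then have "\<forall>v\<in>V. adj (neg_edges E \<sigma>) z v * y v = 0"
      using finite_vertices by (simp add: y_def sum_nonneg_eq_0_iff)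
    then have "adj (neg_edges E \<sigma>) z s * y s = 0" using that(2) by auto
    then show ?thesis using that(2) by (auto simp: adj_def y_def)
  qed
  have no_neg: "{u, v} \<notin> neg_edges E \<sigma>" if "u \<in> ?S1" "v \<in> ?S2" for u v
    using that pos_neg_disjoint[of "{u, v}"] by (auto simp: C1 doubleton_in_complete_bipartite_edges)
  have degree: "vertex_degree (neg_edges E \<sigma>) v = \<delta>"
    if "u \<in> ?S1 \<union> ?S2" "v \<in> V" "u \<noteq> v" "{u, v} \<notin> neg_edges E \<sigma>" for u v
    unfolding \<delta>_def
    by (rule neg.quad_adj_eq_degree[OF ne _ y_eq, of u]) (use that in \<open>auto simp: y_def\<close>)
  obtain s1 s2 where s: "s1 \<in> ?S1" "s2 \<in> ?S2" using S by blast
  \<comment> \<open>Each vertex is compared with a vertex of \<open>S1 \<union> S2\<close> that no negative edge joins to it.\<close>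
  have C2: "vertex_degree (neg_edges E \<sigma>) v = \<delta>" if "v \<in> V" for v
  proof -
    have "v \<in> ?S1 \<or> v \<in> ?S2 \<or> v \<in> ?Z" using that by auto
    then consider "v \<in> ?S1" | "v \<in> ?S2" | "v \<in> ?Z" by blast
    then show ?thesis
    proof cases
      case 1
      then show ?thesis
        using degree[of s2 v] no_neg[of v s2] s by (force simp: insert_commute)
    next
      case 2
      then show ?thesis
        using degree[of s1 v] no_neg[of s1 v] s by force
    next
      case 3
      then show ?thesis
        using degree[of s1 v] C3[of v s1] s by (force simp: insert_commute)
    qed
  qed
  show ?thesis
    unfolding extremal_partition_def
  proof (intro conjI)
    show "regular_graph V (neg_edges E \<sigma>) (min_degree V (neg_edges E \<sigma>))"
      using C2 by (simp add: regular_graph_def \<delta>_def)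
  qed (use C1 S C3 in auto)
qed

text \<open>
  The vector is the least eigenvector of \<open>K\<^bsub>a,b\<^esub>\<close>, scaled by \<open>\<surd>(a b)\<close> to avoid quotients and extended
  by \<open>0\<close>. It is constant on every connected component of \<open>H\<close>, hence an eigenvector of the regular
  graph \<open>H\<close> for \<open>\<delta>\<close>, which is also the value that the bound for \<open>H\<close> takes in the regular case.
\<close>

lemma minimizer_of_extremal_partition:
  assumes part: "extremal_partition S1 S2 Z"
  obtains x where "0 < (\<Sum>v\<in>V. (x v)\<^sup>2)"
    and "quad V weight x = eigenvalue_bound * (\<Sum>v\<in>V. (x v)\<^sup>2)"
proof -
  interpret pos: simple_graph V "pos_edges E \<sigma>" by (rule simple_graph_pos_edges)
  interpret neg: simple_graph V "neg_edges E \<sigma>" by (rule simple_graph_neg_edges)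
  define \<delta> where "\<delta> = min_degree V (neg_edges E \<sigma>)"
  have V: "V = S1 \<union> S2 \<union> Z" and disj: "S1 \<inter> S2 = {}" "S1 \<inter> Z = {}" "S2 \<inter> Z = {}"
    and ne: "S1 \<noteq> {}" "S2 \<noteq> {}"
    and C1: "pos_edges E \<sigma> = complete_bipartite_edges S1 S2"
    and C2: "\<And>v. v \<in> V \<Longrightarrow> vertex_degree (neg_edges E \<sigma>) v = \<delta>"
    and C3: "\<And>z s. z \<in> Z \<Longrightarrow> s \<in> S1 \<union> S2 \<Longrightarrow> {z, s} \<notin> neg_edges E \<sigma>"
    using part by (auto simp: extremal_partition_def regular_graph_def \<delta>_def)
  have fin: "finite S1" "finite S2" "finite Z" using V finite_vertices by auto
  define a b where "a = real (card S1)" and "b = real (card S2)"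
  have ab: "0 < a" "0 < b" using ne fin by (auto simp: a_def b_def card_gt_0_iff)
  have split: "(\<Sum>v\<in>V. f v) = (\<Sum>v\<in>S1. f v) + (\<Sum>v\<in>S2. f v) + (\<Sum>v\<in>Z. f v)" for f :: "'v \<Rightarrow> real"
    unfolding V using fin disj by (subst sum.union_disjoint, auto)+
  define x where "x v = (if v \<in> S1 then sqrt b else if v \<in> S2 then - sqrt a else 0)" for v
  have x1: "x v = sqrt b" if "v \<in> S1" for v using that by (simp add: x_def)
  have x2: "x v = - sqrt a" if "v \<in> S2" for v using that disj by (auto simp: x_def)
  have xZ: "x v = 0" if "v \<in> Z" for v using that disj by (auto simp: x_def)
  have norm: "(\<Sum>v\<in>V. (x v)\<^sup>2) = 2 * a * b"
  proof -
    have "(\<Sum>v\<in>S1. (x v)\<^sup>2) = a * b" "(\<Sum>v\<in>S2. (x v)\<^sup>2) = b * a" "(\<Sum>v\<in>Z. (x v)\<^sup>2) = 0"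
      using ab by (simp_all add: x1 x2 xZ flip: a_def b_def)
    then show ?thesis unfolding split by simp
  qed

  have adj1: "adj (pos_edges E \<sigma>) u v = (if u \<in> S1 \<and> v \<in> S2 \<or> u \<in> S2 \<and> v \<in> S1 then 1 else 0)" for u v
    by (simp only: adj_def C1 doubleton_in_complete_bipartite_edges)
  have restrict: "(\<Sum>v\<in>V. if v \<in> S1 then t else 0) = t * a"
    "(\<Sum>v\<in>V. if v \<in> S2 then t else 0) = t * b" for t :: real
  proof -
    have "V \<inter> {v. v \<in> S1} = S1" "V \<inter> {v. v \<in> S2} = S2" by (auto simp: V)
    then show "(\<Sum>v\<in>V. if v \<in> S1 then t else 0) = t * a" "(\<Sum>v\<in>V. if v \<in> S2 then t else 0) = t * b"
      by (simp_all add: sum.If_cases finite_vertices a_def b_def)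
  qed
  have row1: "(\<Sum>v\<in>V. adj (pos_edges E \<sigma>) u v * x v) = - sqrt (a * b) * x u" if "u \<in> V" for u
  proof -
    have "u \<in> S1 \<or> u \<in> S2 \<or> u \<in> Z" using that by (simp add: V)
    with disj consider "u \<in> S1" "u \<notin> S2" | "u \<in> S2" "u \<notin> S1" | "u \<in> Z" "u \<notin> S1" "u \<notin> S2"
      by blast
    then show ?thesis
    proof cases
      case 1
      then have "(\<Sum>v\<in>V. adj (pos_edges E \<sigma>) u v * x v) = (\<Sum>v\<in>V. if v \<in> S2 then - sqrt a else 0)"
        by (intro sum.cong refl) (simp add: adj1 x2)
      then show ?thesis
        unfolding restrict using 1 ab by (simp add: x1 real_sqrt_mult)
    next
      case 2
      then have "(\<Sum>v\<in>V. adj (pos_edges E \<sigma>) u v * x v) = (\<Sum>v\<in>V. if v \<in> S1 then sqrt b else 0)"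
        by (intro sum.cong refl) (simp add: adj1 x1)
      then show ?thesis
        unfolding restrict using 2 ab by (simp add: x2 real_sqrt_mult)
    next
      case 3
      then show ?thesis by (simp add: adj1 xZ)
    qed
  qed
  have "bipartite V (pos_edges E \<sigma>)"
    unfolding bipartite_def C1 complete_bipartite_edges_def
    using disj by (intro exI[of _ S1] exI[of _ "S2 \<union> Z"]) (auto simp: V)
  then have eb: "edge_bipartiteness V (pos_edges E \<sigma>) = 0"
    by (rule pos.edge_bipartiteness_bipartite)
  have "pos_edges E \<sigma> = (\<lambda>(u, v). {u, v}) ` (S1 \<times> S2)"
    by (auto simp: C1 complete_bipartite_edges_def)
  moreover have "inj_on (\<lambda>(u, v). {u, v}) (S1 \<times> S2)"
    using disj by (auto simp: inj_on_def doubleton_eq_iff)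
  ultimately have "card (pos_edges E \<sigma>) = card S1 * card S2"
    by (simp add: card_image card_cartesian_product)
  then have cut: "pos.max_cut = a * b" by (simp add: eb a_def b_def)

  \<comment> \<open>A negative edge cannot leave \<open>S1\<close>, \<open>S2\<close> or \<open>Z\<close>: all pairs between \<open>S1\<close> and \<open>S2\<close> are positive
    edges, and \<open>Z\<close> is covered by the third condition.\<close>
  have same: "x v = x u" if "{u, v} \<in> neg_edges E \<sigma>" "u \<in> V" "v \<in> V" for u v
  proof -
    have "{u, v} \<notin> complete_bipartite_edges S1 S2"
      using that(1) pos_neg_disjoint[of "{u, v}"] C1 by auto
    then have "\<not> (u \<in> S1 \<and> v \<in> S2)" "\<not> (u \<in> S2 \<and> v \<in> S1)"
      by (simp_all add: doubleton_in_complete_bipartite_edges)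
    moreover have "\<not> (u \<in> Z \<and> v \<in> S1 \<union> S2)" "\<not> (v \<in> Z \<and> u \<in> S1 \<union> S2)"
      using C3[of u v] C3[of v u] that(1) by (auto simp: insert_commute)
    ultimately show ?thesis using that(2,3) by (auto simp: V x1 x2 xZ)
  qed
  have row2: "(\<Sum>v\<in>V. adj (neg_edges E \<sigma>) u v * x v) = \<delta> * x u" if "u \<in> V" for u
  proof -
    have "(\<Sum>v\<in>V. adj (neg_edges E \<sigma>) u v * x v) = (\<Sum>v\<in>V. adj (neg_edges E \<sigma>) u v * x u)"
      using same that by (intro sum.cong refl) (simp add: adj_def)
    also have "\<dots> = real (vertex_degree (neg_edges E \<sigma>) u) * x u"
      by (simp add: neg.vertex_degree_eq_sum_adj[OF that] sum_distrib_right)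
    finally show ?thesis by (simp add: C2 that)
  qed
  have "2 * real (card (neg_edges E \<sigma>)) = real (card V) * real \<delta>"
    using neg.sum_vertex_degree by (simp add: C2)
  then have hsf: "hsf_bound (card V) (card (neg_edges E \<sigma>)) \<delta> = \<delta>"
    by (simp add: hsf_bound_def real_sqrt_divide field_simps)
  have "quad V weight x = (- sqrt (a * b) - \<delta>) * (\<Sum>v\<in>V. (x v)\<^sup>2)"
    using quad_eigenvector[of V "adj (pos_edges E \<sigma>)" x, OF row1]
      quad_eigenvector[of V "adj (neg_edges E \<sigma>)" x, OF row2]
    by (simp add: quad_weight left_diff_distrib)
  moreover have "eigenvalue_bound = - sqrt (a * b) - \<delta>"
    by (simp add: eigenvalue_bound_def cut hsf flip: \<delta>_def)
  ultimately show ?thesis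
    using that[of x] norm ab by simp
qed

end

theorem theorem5p17:
  fixes V :: "'v set" and E :: "'v set set" and \<sigma> :: "'v set \<Rightarrow> real" and vs :: "'v list"
    and n mp mm eb \<delta> :: nat
  assumes "signed_graph V E \<sigma>"
    and "V \<noteq> {}"
    and "distinct vs" and "set vs = V"
    and "n = card V"
    and "mp = card (pos_edges E \<sigma>)"
    and "mm = card (neg_edges E \<sigma>)"
    and "eb = edge_bipartiteness V (pos_edges E \<sigma>)"
    and "\<delta> = min_degree V (neg_edges E \<sigma>)"
  shows "least_eigenvalue (adjacency_matrix vs E \<sigma>)
           \<ge> - sqrt (real mp - real eb) - (real \<delta> - 1) / 2
             - sqrt (2 * real mm - real n * real \<delta> + (1 + real \<delta>)\<^sup>2 / 4)
       \<and> (mp \<ge> 1 \<longrightarrow>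
           (least_eigenvalue (adjacency_matrix vs E \<sigma>)
              = - sqrt (real mp - real eb) - (real \<delta> - 1) / 2
                - sqrt (2 * real mm - real n * real \<delta> + (1 + real \<delta>)\<^sup>2 / 4)
            \<longleftrightarrow>
            (\<exists>S1 S2 Z. V = S1 \<union> S2 \<union> Z \<and> S1 \<inter> S2 = {} \<and> S1 \<inter> Z = {} \<and> S2 \<inter> Z = {}
               \<and> S1 \<noteq> {} \<and> S2 \<noteq> {}
               \<and> pos_edges E \<sigma> = complete_bipartite_edges S1 S2
               \<and> regular_graph V (neg_edges E \<sigma>) \<delta>
               \<and> (\<forall>z\<in>Z. \<forall>s\<in>S1 \<union> S2. {z, s} \<notin> neg_edges E \<sigma>))))"
proof -
  interpret signed_graph V E \<sigma> by fact
  let ?l = "least_eigenvalue (adjacency_matrix vs E \<sigma>)"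
  have bound: "eigenvalue_bound = - sqrt (real mp - real eb) - (real \<delta> - 1) / 2
      - sqrt (2 * real mm - real n * real \<delta> + (1 + real \<delta>)\<^sup>2 / 4)"
    using assms(5-9) by (simp add: eigenvalue_bound_def hsf_bound_def)
  have weight_sym: "weight u v = weight v u" for u v
    by (simp add: weight_def adj_commute[of _ u])
  obtain x where unit: "(\<Sum>v\<in>V. (x v)\<^sup>2) = 1" and x: "quad V weight x = ?l"
    and least: "\<And>y. ?l * (\<Sum>v\<in>V. (y v)\<^sup>2) \<le> quad V weight y"
    by (rule least_eigenvalue_rayleigh[of vs weight, folded adjacency_matrix_weight])
      (use assms(2-4) weight_sym in auto)
  have ge: "eigenvalue_bound \<le> ?l"
    using quad_weight_ge[OF assms(2) unit] x by simp
  have "?l = eigenvalue_bound \<longleftrightarrow> (\<exists>S1 S2 Z. extremal_partition S1 S2 Z)" if "mp \<ge> 1"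
  proof
    assume "?l = eigenvalue_bound"
    moreover have "pos_edges E \<sigma> \<noteq> {}" using that assms(6) by auto
    ultimately show "\<exists>S1 S2 Z. extremal_partition S1 S2 Z"
      using extremal_partition_of_minimizer[OF assms(2) _ unit] x by auto
  next
    assume "\<exists>S1 S2 Z. extremal_partition S1 S2 Z"
    then obtain S1 S2 Z where "extremal_partition S1 S2 Z" by blast
    then obtain y where y: "0 < (\<Sum>v\<in>V. (y v)\<^sup>2)"
      "quad V weight y = eigenvalue_bound * (\<Sum>v\<in>V. (y v)\<^sup>2)"
      by (rule minimizer_of_extremal_partition)
    with least[of y] have "?l \<le> eigenvalue_bound" by simp
    with ge show "?l = eigenvalue_bound" by simp
  qed
  with ge show ?thesis
    unfolding bound extremal_partition_def assms(9)[symmetric] by simp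
qed

end
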